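(* Let $E$ be a vector space over a field $\mathbb{K}$, let $B=\{\mathbf{u}_\lambda\}_{\lambda\in L}$ be an algebraic (Hamel) basis of $E$ indexed by a well-ordered set $L$ with $\emptyset\notin L$, and let $E_B$ be the set of algebraic vectors of $E$ on $B$, equipped with the scalar multiplication $\cdot:\mathbb{K}\times E_B\to E_B$ and the addition $+:E_B\times E_B\to E_B$ of algebraic vectors. Then $E$ and $E_B$ are isomorphic vector spaces (over $\mathbb{K}$).
   Context: Setting: $E$ is an arbitrary vector space over a field $\mathbb{K}$ (finite- or infinite-dimensional, possibly with uncountable basis, possibly trivial). $B=\{\mathbf{u}_\lambda\}_{\lambda\in L}$ is a Hamel basis of $E$, with distinct indices labelling distinct basis elements; $L$ is well-ordered and $\emptyset\notin L$ (if $E=\{\mathbf 0\}$ then $B=\emptyset$ and $L=\emptyset$). Notation: $\mathcal{P}_n(L)$ is the set of subsets of $L$ with exactly $n$ elements, $\mathbb{K}^*=\mathbb{K}\setminus\{0\}$ and $\mathbb{N}^*=\{1,2,3,\dots\}$. The set $E_B$: put $E_B^*=\bigcup_{n=1}^{N}\mathcal{P}_n(L)\times(\mathbb{K}^* )^n$ if $L$ is finite with $N$ elements, and $E_B^*=\bigcup_{n\in\mathbb{N}^*}\mathcal{P}_n(L)\times(\mathbb{K}^* )^n$ otherwise. Then $E_B=E_B^*\cup\{(\emptyset,\emptyset)\}$. Write $\mathbf{0}=(\emptyset,\emptyset)$ for this element of $E_B$. Index set and components: for $\mathbf{v}\in E_B$, $L_{\mathbf v}$ denotes its first coordinate (so $L_{\mathbf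 0}=\emptyset$). If $\mathbf{v}\neq\mathbf 0$ and $L_{\mathbf v}=\{\lambda_1<\lambda_2<\dots<\lambda_n\}$ in the order of $L$, and $\mathbf{v}=(L_{\mathbf v},(\alpha_{\lambda_1},\dots,\alpha_{\lambda_n}))$, then the component of $\mathbf v$ at the index $\lambda_i\in L_{\mathbf v}$ is $v^{\lambda_i}=\alpha_{\lambda_i}$, the $i$-th entry of the tuple. All components are nonzero, and $\mathbf 0$ has no components. Scalar multiplication: for $\kappa\in\mathbb{K}$ and $\mathbf v\in E_B$, if $\kappa\neq0$ and $\mathbf v=(L_{\mathbf v},(\alpha_{\lambda_1},\dots,\alpha_{\lambda_n}))\neq\mathbf 0$, then $\kappa\cdot\mathbf v=(L_{\mathbf v},(\kappa\alpha_{\lambda_1},\dots,\kappa\alpha_{\lambda_n}))$; if $\kappa=0$ or $\mathbf v=\mathbf 0$, then $\kappa\cdot\mathbf v=\mathbf 0$. Addition: for $\mathbf v,\mathbf w\in E_B$ let $0_{\mathbf v\mathbf w}=\{i\in L_{\mathbf v}\cap L_{\mathbf w} : v^i+w^i=0\}$. Then $\mathbf v+\mathbf w$ is the element of $E_B$ with index set $L_{\mathbf v+\mathbf w}=(L_{\mathbf v}\cup L_{\mathbf w})\setminus 0_{\mathbf v\mathbf w}$ and components, for $i\in L_{\mathbf v+\mathbf w}$ (listed in increasing order of index), $(v+w)^i=v^i$ if $i\in L_{\mathbf v}\setminus L_{\mathbf w}$; $(v+w)^i=v^i+w^i$ if $i\in(L_{\mathbf v}\cap L_{\mathbf w})\setminus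 0_{\mathbf v\mathbf w}$; $(v+w)^i=w^i$ if $i\in L_{\mathbf w}\setminus L_{\mathbf v}$. If $L_{\mathbf v+\mathbf w}=\emptyset$, then $\mathbf v+\mathbf w=\mathbf 0$. *)

theory Defs
  imports "Jordan_Normal_Form.Missing_VectorSpace" "HOL-Library.Ramsey"
begin

text \<open>Algebraic vectors over a field \<open>K\<close> on an index set \<open>L\<close> that is well-ordered by the
  reflexive relation \<open>r\<close>: pairs of a finite index set and a tuple of nonzero scalars, the tuple
  being encoded as a list. The set of \<open>n\<close>-element subsets of \<open>L\<close> is \<open>nsets L n\<close>.\<close>

type_synonym ('l, 'k) alg_vec = "'l set \<times> 'k list"

definition alg_zero :: "('l, 'k) alg_vec" where
  "alg_zero = ({}, [])"

definition nonzero_tuples :: "('k, 'n) ring_scheme \<Rightarrow> nat \<Rightarrow> 'k list set" where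
  "nonzero_tuples K n = {xs. length xs = n \<and> set xs \<subseteq> carrier K - {\<zero>\<^bsub>K\<^esub>}}"

definition alg_vectors_nonzero :: "('k, 'n) ring_scheme \<Rightarrow> 'l set \<Rightarrow> ('l, 'k) alg_vec set" where
  "alg_vectors_nonzero K L =
     (if finite L then (\<Union>n\<in>{1..card L}. nsets L n \<times> nonzero_tuples K n)
      else (\<Union>n\<in>{1..}. nsets L n \<times> nonzero_tuples K n))"

definition alg_vectors :: "('k, 'n) ring_scheme \<Rightarrow> 'l set \<Rightarrow> ('l, 'k) alg_vec set" where
  "alg_vectors K L = alg_vectors_nonzero K L \<union> {alg_zero}"

text \<open>The increasing enumeration of a finite set \<open>S\<close> of indices with respect to \<open>r\<close>.\<close>

definition index_list :: "'l rel \<Rightarrow> 'l set \<Rightarrow> 'l list" where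
  "index_list r S =
     (THE is. distinct is \<and> set is = S \<and> sorted_wrt (\<lambda>i j. (i, j) \<in> r) is)"

text \<open>The component of \<open>v\<close> at \<open>i\<close>; it is only meaningful for \<open>i \<in> fst v\<close>.\<close>

definition alg_comp :: "'l rel \<Rightarrow> ('l, 'k) alg_vec \<Rightarrow> 'l \<Rightarrow> 'k" where
  "alg_comp r v i = the (map_of (zip (index_list r (fst v)) (snd v)) i)"

definition alg_smult ::
    "('k, 'n) ring_scheme \<Rightarrow> 'k \<Rightarrow> ('l, 'k) alg_vec \<Rightarrow> ('l, 'k) alg_vec" where
  "alg_smult K \<kappa> v =
     (if \<kappa> = \<zero>\<^bsub>K\<^esub> \<or> v = alg_zero then alg_zero
      else (fst v, map (\<lambda>\<alpha>. \<kappa> \<otimes>\<^bsub>K\<^esub> \<alpha>) (snd v)))"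

definition cancel_indices ::
    "('k, 'n) ring_scheme \<Rightarrow> 'l rel \<Rightarrow> ('l, 'k) alg_vec \<Rightarrow> ('l, 'k) alg_vec \<Rightarrow> 'l set" where
  "cancel_indices K r v w =
     {i \<in> fst v \<inter> fst w. alg_comp r v i \<oplus>\<^bsub>K\<^esub> alg_comp r w i = \<zero>\<^bsub>K\<^esub>}"

definition add_indices ::
    "('k, 'n) ring_scheme \<Rightarrow> 'l rel \<Rightarrow> ('l, 'k) alg_vec \<Rightarrow> ('l, 'k) alg_vec \<Rightarrow> 'l set" where
  "add_indices K r v w = (fst v \<union> fst w) - cancel_indices K r v w"

definition add_comp ::
    "('k, 'n) ring_scheme \<Rightarrow> 'l rel \<Rightarrow> ('l, 'k) alg_vec \<Rightarrow> ('l, 'k) alg_vec \<Rightarrow> 'l \<Rightarrow> 'k" where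
  "add_comp K r v w i =
     (if i \<in> fst v - fst w then alg_comp r v i
      else if i \<in> fst w - fst v then alg_comp r w i
      else alg_comp r v i \<oplus>\<^bsub>K\<^esub> alg_comp r w i)"

definition alg_add ::
    "('k, 'n) ring_scheme \<Rightarrow> 'l rel \<Rightarrow> ('l, 'k) alg_vec \<Rightarrow> ('l, 'k) alg_vec
      \<Rightarrow> ('l, 'k) alg_vec" where
  "alg_add K r v w =
     (if add_indices K r v w = {} then alg_zero
      else (add_indices K r v w,
            map (add_comp K r v w) (index_list r (add_indices K r v w))))"

text \<open>The record type of modules extends that of rings; its fields \<open>mult\<close> and \<open>one\<close> play no role
  for modules and are left unspecified.\<close>

definition alg_space ::
    "('k, 'n) ring_scheme \<Rightarrow> 'l set \<Rightarrow> 'l rel \<Rightarrow> ('k, ('l, 'k) alg_vec) module" where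
  "alg_space K L r =
     \<lparr>carrier = alg_vectors K L, mult = undefined, one = undefined,
      zero = alg_zero, add = alg_add K r, smult = alg_smult K\<rparr>"

definition vectorspace_iso ::
    "('k, 'n) ring_scheme \<Rightarrow> ('k, 'v, 'a) module_scheme \<Rightarrow> ('k, 'w, 'b) module_scheme \<Rightarrow> bool" where
  "vectorspace_iso K V W \<longleftrightarrow>
     (\<exists>T. linear_map K V W T \<and> bij_betw T (carrier V) (carrier W))"

end

theory Submission
  imports Defs
begin

text \<open>An algebraic vector is determined by its coordinate function, extended by zero outside its
  index set, and the operations on algebraic vectors are the pointwise ones on coordinate functions.
  So \<open>v \<mapsto> \<Sum>\<^sub>i v\<^sup>i u\<^sub>i\<close> respects the operations; it is bijective because \<open>u\<close> is a basis, and the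
  vector space axioms are pulled back along it.\<close>

subsection \<open>Increasing enumerations\<close>

text \<open>If the heads differed, each would occur in the tail of the other list, so
  \<open>r\<close> would relate them in both directions, against antisymmetry. Distinctness then
  makes the tails agree as sets.\<close>

lemma sorted_wrt_distinct_set_unique:
  assumes "antisym r"
    and "distinct xs" "sorted_wrt (\<lambda>i j. (i, j) \<in> r) xs"
    and "distinct ys" "sorted_wrt (\<lambda>i j. (i, j) \<in> r) ys"
    and "set xs = set ys"
  shows "xs = ys"
  using assms(2-)
proof (induction xs arbitrary: ys)
  case Nil
  then show ?case by simp
next
  case (Cons x xs)
  then obtain y zs where ys: "ys = y # zs"
    by (cases ys) auto
  have "x = y"
  proof (rule ccontr)
    assume "x \<noteq> y"
    then have "x \<in> set zs" "y \<in> set xs"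
      using Cons.prems(5) ys by auto
    then have "(y, x) \<in> r" "(x, y) \<in> r"
      using Cons.prems(2,4) ys by auto
    with \<open>x \<noteq> y\<close> show False
      using \<open>antisym r\<close> by (auto dest: antisymD)
  qed
  moreover have "set xs = set zs"
    using Cons.prems(1,3,5) ys \<open>x = y\<close> by auto
  ultimately show ?case
    using Cons ys by auto
qed

text \<open>Induction on the cardinality: the least element goes in front of an enumeration of the
  rest.\<close>

lemma well_order_on_sorted_list_exists:
  assumes wo: "well_order_on L r" and "finite S" and "S \<subseteq> L"
  shows "\<exists>xs. distinct xs \<and> set xs = S \<and> sorted_wrt (\<lambda>i j. (i, j) \<in> r) xs"
  using assms(2,3)
proof (induction "card S" arbitrary: S)
  case 0
  then show ?case by (intro exI[of _ "[]"]) simp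
next
  case (Suc n)
  have "S \<noteq> {}" using Suc.hyps(2) by auto
  have "wf (r - Id)" and "total_on L r" and "refl_on L r"
    using wo by (auto simp: well_order_on_def linear_order_on_def partial_order_on_def
        preorder_on_def)
  obtain m where m: "m \<in> S" "\<And>y. (y, m) \<in> r - Id \<Longrightarrow> y \<notin> S"
    using wfE_min'[OF \<open>wf (r - Id)\<close> \<open>S \<noteq> {}\<close>] by metis
  \<comment> \<open>Well-foundedness only makes \<open>m\<close> minimal for the strict part of
    \<open>r\<close>; totality turns this into least, and reflexivity covers
    \<open>y = m\<close>.\<close>
  have min: "(m, y) \<in> r" if "y \<in> S" for y
  proof -
    have "m \<in> L" "y \<in> L" using m(1) that Suc.prems(2) by auto
    moreover have "y = m \<or> (y, m) \<notin> r" using m(2)[of y] that by auto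
    ultimately show ?thesis
      using \<open>total_on L r\<close> \<open>refl_on L r\<close> by (metis refl_onD total_on_def)
  qed
  have "n = card (S - {m})" "finite (S - {m})" "S - {m} \<subseteq> L"
    using Suc.hyps(2) Suc.prems m(1) by auto
  then obtain xs where "distinct xs" "set xs = S - {m}" "sorted_wrt (\<lambda>i j. (i, j) \<in> r) xs"
    using Suc.hyps(1) by blast
  then show ?case
    using m(1) min by (intro exI[of _ "m # xs"]) auto
qed

text \<open>Existence and uniqueness of the sorted enumeration give the definite description its
  meaning.\<close>

lemma index_list:
  assumes wo: "well_order_on L r" and "finite S" and "S \<subseteq> L"
  shows "distinct (index_list r S)" and "set (index_list r S) = S"
proof -
  have "antisym r"
    using wo by (simp add: well_order_on_def linear_order_on_def partial_order_on_def)
  then have "\<exists>!xs. distinct xs \<and> set xs = S \<and> sorted_wrt (\<lambda>i j. (i, j) \<in> r) xs"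
    using well_order_on_sorted_list_exists[OF assms] sorted_wrt_distinct_set_unique by metis
  from theI'[OF this] show "distinct (index_list r S)" "set (index_list r S) = S"
    by (simp_all add: index_list_def)
qed

lemma length_index_list:
  assumes "well_order_on L r" and "finite S" and "S \<subseteq> L"
  shows "length (index_list r S) = card S"
  using index_list[OF assms] distinct_card by metis

subsection \<open>Components of algebraic vectors\<close>

text \<open>The size \<open>n\<close> in the union is the cardinality of the index set, and for
  finite \<open>L\<close> the bound \<open>card L\<close> on it is automatic, so both cases of the
  definition merge. The empty index set forces the empty tuple and accounts for
  \<open>alg_zero\<close>.\<close>

lemma mem_alg_vectors_iff:
  "v \<in> alg_vectors K L \<longleftrightarrow>
     finite (fst v) \<and> fst v \<subseteq> L \<and> length (snd v) = card (fst v) \<and>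
     set (snd v) \<subseteq> carrier K - {\<zero>\<^bsub>K\<^esub>}"
proof -
  have "v \<in> alg_vectors_nonzero K L \<longleftrightarrow>
     fst v \<noteq> {} \<and> finite (fst v) \<and> fst v \<subseteq> L \<and> length (snd v) = card (fst v) \<and>
     set (snd v) \<subseteq> carrier K - {\<zero>\<^bsub>K\<^esub>}"
    by (cases v) (auto simp: alg_vectors_nonzero_def nsets_def nonzero_tuples_def Suc_le_eq
        card_gt_0_iff card_mono)
  then show ?thesis
    by (cases v) (auto simp: alg_vectors_def alg_zero_def)
qed

lemma alg_comp_map:
  assumes "well_order_on L r" and "finite S" and "S \<subseteq> L" and "i \<in> S"
  shows "alg_comp r (S, map f (index_list r S)) i = f i"
  using index_list[OF assms(1-3)] assms(4) by (simp add: alg_comp_def map_of_zip_map)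

text \<open>The enumeration has no repetitions and is as long as the tuple, so looking up its
  \<open>n\<close>-th index returns the \<open>n\<close>-th entry.\<close>

lemma snd_eq_map_alg_comp:
  assumes wo: "well_order_on L r" and v: "v \<in> alg_vectors K L"
  shows "snd v = map (alg_comp r v) (index_list r (fst v))"
proof (rule nth_equalityI)
  have fin: "finite (fst v)" "fst v \<subseteq> L" and len: "length (snd v) = card (fst v)"
    using v by (simp_all add: mem_alg_vectors_iff)
  note il = index_list[OF wo fin] length_index_list[OF wo fin]
  show "length (snd v) = length (map (alg_comp r v) (index_list r (fst v)))"
    using len il by simp
  show "snd v ! n = map (alg_comp r v) (index_list r (fst v)) ! n" if "n < length (snd v)" for n
    using that len il by (simp add: alg_comp_def map_of_zip_nth)
qed

lemma alg_comp_carrier: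
  assumes wo: "well_order_on L r" and v: "v \<in> alg_vectors K L" and "i \<in> fst v"
  shows "alg_comp r v i \<in> carrier K - {\<zero>\<^bsub>K\<^esub>}"
proof -
  have "i \<in> set (index_list r (fst v))"
    using v assms(3) by (simp add: mem_alg_vectors_iff index_list[OF wo])
  then have "alg_comp r v i \<in> set (snd v)"
    by (subst snd_eq_map_alg_comp[OF wo v]) simp
  then show ?thesis
    using v by (auto simp: mem_alg_vectors_iff)
qed

lemma map_index_list_mem_alg_vectors:
  assumes wo: "well_order_on L r" and "finite S" and "S \<subseteq> L"
    and "\<And>i. i \<in> S \<Longrightarrow> f i \<in> carrier K - {\<zero>\<^bsub>K\<^esub>}"
  shows "(S, map f (index_list r S)) \<in> alg_vectors K L"
  using assms(2-) index_list[OF assms(1-3)] length_index_list[OF assms(1-3)]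
  by (auto simp: mem_alg_vectors_iff)

section \<open>Coordinate functions\<close>

definition alg_coord ::
    "('k, 'n) ring_scheme \<Rightarrow> 'l rel \<Rightarrow> ('l, 'k) alg_vec \<Rightarrow> 'l \<Rightarrow> 'k" where
  "alg_coord K r v i = (if i \<in> fst v then alg_comp r v i else \<zero>\<^bsub>K\<^esub>)"

text \<open>Entries of the tuple are nonzero, so the support of the coordinate function is exactly
  the index set.\<close>

lemma alg_coord_eq_zero_iff:
  assumes "well_order_on L r" and "v \<in> alg_vectors K L"
  shows "alg_coord K r v i = \<zero>\<^bsub>K\<^esub> \<longleftrightarrow> i \<notin> fst v"
  using alg_comp_carrier[OF assms] by (auto simp: alg_coord_def)

text \<open>The coordinate function gives back the index set as its support, and then the tuple as
  its values along the enumeration of that set.\<close>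

lemma alg_coord_inject:
  assumes wo: "well_order_on L r" and v: "v \<in> alg_vectors K L" and w: "w \<in> alg_vectors K L"
    and eq: "\<And>i. alg_coord K r v i = alg_coord K r w i"
  shows "v = w"
proof -
  have fst: "fst v = fst w"
    using alg_coord_eq_zero_iff[OF wo v] alg_coord_eq_zero_iff[OF wo w] eq by auto
  have "set (index_list r (fst w)) = fst w"
    using w by (simp add: mem_alg_vectors_iff index_list[OF wo])
  then have "map (alg_comp r v) (index_list r (fst w)) = map (alg_comp r w) (index_list r (fst w))"
    using eq fst by (auto simp: alg_coord_def) metis
  then have "snd v = snd w"
    using snd_eq_map_alg_comp[OF wo v] snd_eq_map_alg_comp[OF wo w] fst by simp
  with fst show ?thesis by (simp add: prod_eq_iff)
qed

lemma alg_zero_mem: "alg_zero \<in> alg_vectors K L"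
  by (simp add: alg_vectors_def)

lemma alg_coord_zero: "alg_coord K r alg_zero i = \<zero>\<^bsub>K\<^esub>"
  by (simp add: alg_coord_def alg_zero_def)

section \<open>Coordinates of scalar multiples and sums\<close>

context field
begin

lemma alg_coord_carrier:
  assumes "well_order_on L r" and "v \<in> alg_vectors R L"
  shows "alg_coord R r v i \<in> carrier R"
  using alg_comp_carrier[OF assms] by (auto simp: alg_coord_def)

lemma alg_smult:
  assumes wo: "well_order_on L r" and v: "v \<in> alg_vectors R L" and a: "a \<in> carrier R"
  shows alg_smult_mem: "alg_smult R a v \<in> alg_vectors R L"
    and alg_coord_smult: "alg_coord R r (alg_smult R a v) i = a \<otimes> alg_coord R r v i"
proof -
  have "alg_smult R a v \<in> alg_vectors R L \<and>
    alg_coord R r (alg_smult R a v) i = a \<otimes> alg_coord R r v i"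
  proof (cases "a = \<zero> \<or> v = alg_zero")
    case True
    then show ?thesis
      using a alg_coord_carrier[OF wo v]
      by (auto simp: alg_smult_def alg_zero_mem alg_coord_zero)
  next
    case False
    have fin: "finite (fst v)" "fst v \<subseteq> L"
      using v by (simp_all add: mem_alg_vectors_iff)
    have eq: "alg_smult R a v =
        (fst v, map (\<lambda>i. a \<otimes> alg_comp r v i) (index_list r (fst v)))"
      using False by (simp add: alg_smult_def) (subst snd_eq_map_alg_comp[OF wo v], simp)
    \<comment> \<open>A field has no zero divisors, so no index is lost under a nonzero
      scalar.\<close>
    have "a \<otimes> alg_comp r v i \<in> carrier R - {\<zero>}" if "i \<in> fst v" for i
      using alg_comp_carrier[OF wo v that] a False by (auto simp: integral_iff)
    then have "alg_smult R a v \<in> alg_vectors R L"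
      unfolding eq using fin by (intro map_index_list_mem_alg_vectors[OF wo])
    moreover have "alg_coord R r (alg_smult R a v) i = a \<otimes> alg_coord R r v i"
      unfolding eq using a by (simp add: alg_coord_def alg_comp_map[OF wo fin])
    ultimately show ?thesis by blast
  qed
  then show "alg_smult R a v \<in> alg_vectors R L"
    and "alg_coord R r (alg_smult R a v) i = a \<otimes> alg_coord R r v i"
    by blast+
qed

lemma alg_add:
  assumes wo: "well_order_on L r" and v: "v \<in> alg_vectors R L" and w: "w \<in> alg_vectors R L"
  shows alg_add_mem: "alg_add R r v w \<in> alg_vectors R L"
    and alg_coord_add:
      "alg_coord R r (alg_add R r v w) i = alg_coord R r v i \<oplus> alg_coord R r w i"
proof -
  let ?S = "add_indices R r v w"
  have fin: "finite ?S" "?S \<subseteq> L"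
    using v w by (auto simp: mem_alg_vectors_iff add_indices_def)
  \<comment> \<open>The separate case of \<open>alg_add\<close> is absorbed: an empty
    \<open>?S\<close> has an empty enumeration, and the pair is \<open>alg_zero\<close>.\<close>
  have eq: "alg_add R r v w = (?S, map (add_comp R r v w) (index_list r ?S))"
    using index_list(2)[OF wo fin] by (auto simp: alg_add_def alg_zero_def)
  note [simp] = alg_comp_carrier[OF wo v, simplified] alg_comp_carrier[OF wo w, simplified]
  have "add_comp R r v w i \<in> carrier R - {\<zero>}" if "i \<in> ?S" for i
    using that by (auto simp: add_indices_def cancel_indices_def add_comp_def)
  then show "alg_add R r v w \<in> alg_vectors R L"
    unfolding eq using fin by (intro map_index_list_mem_alg_vectors[OF wo])
  show "alg_coord R r (alg_add R r v w) i = alg_coord R r v i \<oplus> alg_coord R r w i"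
    unfolding eq alg_coord_def fst_conv
    \<comment> \<open>An index outside \<open>?S\<close> lies in neither index set or is cancelled;
      in both cases the coordinates add up to zero. The components on \<open>?S\<close> are
      evaluated first, while \<open>?S\<close> is still folded.\<close>
    by (cases "i \<in> ?S")
      (auto simp: alg_comp_map[OF wo fin], auto simp: add_indices_def cancel_indices_def add_comp_def)
qed

end

subsection \<open>The isomorphism\<close>

text \<open>Each equational axiom in \<open>W\<close> can be checked after applying the injective
  map \<open>f\<close>, which carries it to the corresponding law of \<open>V\<close>. Only additive
  inverses call for surjectivity.\<close>

lemma vectorspace_transport:
  fixes W :: "('k, 'w, 'b) module_scheme"
  assumes "vectorspace K V"
    and bij: "bij_betw f (carrier W) (carrier V)"
    and zero: "\<zero>\<^bsub>W\<^esub> \<in> carrier W" "f \<zero>\<^bsub>W\<^esub> = \<zero>\<^bsub>V\<^esub>"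
    and add: "\<And>x y. x \<in> carrier W \<Longrightarrow> y \<in> carrier W \<Longrightarrow> x \<oplus>\<^bsub>W\<^esub> y \<in> carrier W"
      "\<And>x y. x \<in> carrier W \<Longrightarrow> y \<in> carrier W \<Longrightarrow> f (x \<oplus>\<^bsub>W\<^esub> y) = f x \<oplus>\<^bsub>V\<^esub> f y"
    and smult: "\<And>a x. a \<in> carrier K \<Longrightarrow> x \<in> carrier W \<Longrightarrow> a \<odot>\<^bsub>W\<^esub> x \<in> carrier W"
      "\<And>a x. a \<in> carrier K \<Longrightarrow> x \<in> carrier W \<Longrightarrow> f (a \<odot>\<^bsub>W\<^esub> x) = a \<odot>\<^bsub>V\<^esub> f x"
  shows "vectorspace K W" and "vectorspace_iso K V W"
proof -
  interpret V: vectorspace K V by fact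
  have fV: "f x \<in> carrier V" if "x \<in> carrier W" for x
    using bij that by (auto simp: bij_betw_def)
  have eqI: "x = y" if "x \<in> carrier W" "y \<in> carrier W" "f x = f y" for x y
    using bij that by (auto simp: bij_betw_def inj_on_def)
  have "abelian_group W"
  proof (rule abelian_groupI)
    show "\<exists>y\<in>carrier W. y \<oplus>\<^bsub>W\<^esub> x = \<zero>\<^bsub>W\<^esub>" if x: "x \<in> carrier W" for x
    proof -
      \<comment> \<open>A preimage of the negative of \<open>f x\<close> serves as the negative of
        \<open>x\<close>.\<close>
      have "\<ominus>\<^bsub>V\<^esub> f x \<in> f ` carrier W"
        using bij fV[OF x] by (simp add: bij_betw_def)
      then obtain y where y: "y \<in> carrier W" "f y = \<ominus>\<^bsub>V\<^esub> f x" by auto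
      then have "y \<oplus>\<^bsub>W\<^esub> x = \<zero>\<^bsub>W\<^esub>"
        using x fV zero add by (intro eqI) (simp_all add: V.M.l_neg)
      with y show ?thesis by blast
    qed
  qed (auto intro!: eqI simp: zero add fV V.M.add.m_ac)
  moreover have "field K" by (rule V.field_axioms)
  ultimately show vs: "vectorspace K W"
    unfolding vectorspace_def
    by (auto intro!: module.intro module_axioms.intro eqI V.R.is_cring V.M.abelian_group_axioms
        simp: add smult fV V.smult_l_distr V.smult_r_distr V.smult_assoc1)
  interpret W: vectorspace K W by (rule vs)
  \<comment> \<open>The isomorphism has to run from \<open>V\<close> to \<open>W\<close>, hence the
    inverse of \<open>f\<close>; its linearity is again checked after applying
    \<open>f\<close>.\<close>
  let ?g = "inv_into (carrier W) f"
  have gW: "?g y \<in> carrier W" and fg: "f (?g y) = y" if "y \<in> carrier V" for y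
    using bij that by (auto simp: bij_betw_def inv_into_into f_inv_into_f)
  have "linear_map K V W ?g"
    by unfold_locales
      (auto intro!: eqI simp: LinearCombinations.module_hom_def gW fg add smult)
  then show "vectorspace_iso K V W"
    using bij_betw_inv_into[OF bij] by (auto simp: vectorspace_iso_def)
qed

section \<open>Linear combinations over an indexed basis\<close>

locale indexed_basis = vectorspace +
  fixes L :: "'l set" and r :: "'l rel" and u :: "'l \<Rightarrow> 'c"
  assumes well_order: "well_order_on L r"
    and inj: "inj_on u L"
    and basis: "basis (u ` L)"
begin

lemma u_closed: "i \<in> L \<Longrightarrow> u i \<in> carrier V"
  using basis by (auto simp: basis_def)

text \<open>Since \<open>u\<close> is injective on \<open>L\<close>, a sum over indices can be
  reindexed as one over basis vectors. This connects families to \<open>lincomb\<close>, whose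
  coefficients depend on vectors.\<close>

lemma finsum_u_eq_lincomb:
  assumes "finite F" and "F \<subseteq> L" and "a \<in> F \<rightarrow> carrier K"
  shows "(\<Oplus>\<^bsub>V\<^esub>i\<in>F. a i \<odot>\<^bsub>V\<^esub> u i) = lincomb (\<lambda>x. a (inv_into L u x)) (u ` F)"
proof -
  have inv: "inv_into L u (u i) = i" if "i \<in> F" for i
    using that assms(2) inj by auto
  have "lincomb (\<lambda>x. a (inv_into L u x)) (u ` F) =
      (\<Oplus>\<^bsub>V\<^esub>i\<in>F. a (inv_into L u (u i)) \<odot>\<^bsub>V\<^esub> u i)"
    unfolding lincomb_def using assms inj inv
    by (intro M.finsum_reindex) (auto simp: Pi_iff u_closed subset_iff inj_on_subset)
  also have "\<dots> = (\<Oplus>\<^bsub>V\<^esub>i\<in>F. a i \<odot>\<^bsub>V\<^esub> u i)"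
    using assms inv by (intro M.finsum_cong') (auto simp: Pi_iff u_closed subset_iff)
  finally show ?thesis by simp
qed

lemma finsum_u_eq_zero:
  assumes F: "finite F" "F \<subseteq> L" and a: "a \<in> F \<rightarrow> carrier K"
    and sum: "(\<Oplus>\<^bsub>V\<^esub>i\<in>F. a i \<odot>\<^bsub>V\<^esub> u i) = \<zero>\<^bsub>V\<^esub>" and i: "i \<in> F"
  shows "a i = \<zero>\<^bsub>K\<^esub>"
proof (rule ccontr)
  assume "a i \<noteq> \<zero>\<^bsub>K\<^esub>"
  have inv: "inv_into L u (u j) = j" if "j \<in> F" for j
    using that F inj by auto
  have "lin_dep (u ` L)"
    unfolding lin_dep_def
  \<comment> \<open>The witnesses are fixed by the two goals shown below: the image of
    \<open>F\<close> under \<open>u\<close>, the coefficients moved along the inverse of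
    \<open>u\<close>, and the vector \<open>u i\<close>.\<close>
  proof (intro exI conjI)
    show "lincomb (\<lambda>x. a (inv_into L u x)) (u ` F) = \<zero>\<^bsub>V\<^esub>"
      using sum finsum_u_eq_lincomb[OF F a] by simp
    show "a (inv_into L u (u i)) \<noteq> \<zero>\<^bsub>K\<^esub>"
      using \<open>a i \<noteq> \<zero>\<^bsub>K\<^esub>\<close> inv i by simp
  qed (use F a i inv in auto)
  with basis show False by (simp add: basis_def)
qed

section \<open>The evaluation map and its linearity\<close>

definition of_alg :: "('l, 'a) alg_vec \<Rightarrow> 'c" where
  "of_alg v = (\<Oplus>\<^bsub>V\<^esub>i\<in>fst v. alg_coord K r v i \<odot>\<^bsub>V\<^esub> u i)"

lemmas coord_closed = alg_coord_carrier[OF well_order]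

text \<open>Coordinates vanish off the index set, so enlarging the range adds only zero terms.
  Vectors with different index sets can thus be summed over a common one.\<close>

lemma of_alg_eq_finsum:
  assumes v: "v \<in> alg_vectors K L" and "finite F" "F \<subseteq> L" "fst v \<subseteq> F"
  shows "of_alg v = (\<Oplus>\<^bsub>V\<^esub>i\<in>F. alg_coord K r v i \<odot>\<^bsub>V\<^esub> u i)"
  unfolding of_alg_def using assms coord_closed[OF v]
  by (intro M.add.finprod_mono_neutral_cong_left)
    (auto simp: alg_coord_def u_closed subset_iff)

lemma of_alg_closed:
  assumes "v \<in> alg_vectors K L"
  shows "of_alg v \<in> carrier V"
  unfolding of_alg_def using assms coord_closed[OF assms]
  by (intro M.finsum_closed) (auto simp: mem_alg_vectors_iff u_closed subset_iff)

lemma of_alg_zero: "of_alg alg_zero = \<zero>\<^bsub>V\<^esub>"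
  by (simp add: of_alg_def alg_zero_def)

lemma of_alg_add:
  assumes v: "v \<in> alg_vectors K L" and w: "w \<in> alg_vectors K L"
  shows "of_alg (alg_add K r v w) = of_alg v \<oplus>\<^bsub>V\<^esub> of_alg w"
proof -
  let ?s = "alg_add K r v w"
  \<comment> \<open>A common range for all three sums; cancellation may make \<open>fst ?s\<close>
    smaller than the union of the other two.\<close>
  let ?F = "fst v \<union> fst w \<union> fst ?s"
  have s: "?s \<in> alg_vectors K L" by (rule alg_add_mem[OF well_order v w])
  have F: "finite ?F" "?F \<subseteq> L"
    using v w s by (auto simp: mem_alg_vectors_iff)
  note closed = coord_closed[OF v] coord_closed[OF w] u_closed[OF subsetD[OF F(2)]]
  have "of_alg ?s = (\<Oplus>\<^bsub>V\<^esub>i\<in>?F. alg_coord K r ?s i \<odot>\<^bsub>V\<^esub> u i)"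
    using s F by (intro of_alg_eq_finsum) auto
  also have "\<dots> = (\<Oplus>\<^bsub>V\<^esub>i\<in>?F. alg_coord K r v i \<odot>\<^bsub>V\<^esub> u i \<oplus>\<^bsub>V\<^esub> alg_coord K r w i \<odot>\<^bsub>V\<^esub> u i)"
    using closed
    by (intro M.finsum_cong')
      (simp_all add: Pi_iff alg_coord_add[OF well_order v w] smult_l_distr)
  also have "\<dots> = (\<Oplus>\<^bsub>V\<^esub>i\<in>?F. alg_coord K r v i \<odot>\<^bsub>V\<^esub> u i) \<oplus>\<^bsub>V\<^esub>
      (\<Oplus>\<^bsub>V\<^esub>i\<in>?F. alg_coord K r w i \<odot>\<^bsub>V\<^esub> u i)"
    using closed by (intro M.finsum_addf) (simp_all add: Pi_iff)
  also have "\<dots> = of_alg v \<oplus>\<^bsub>V\<^esub> of_alg w"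
    by (subst (1 2) of_alg_eq_finsum[OF _ F]) (use v w in auto)
  finally show ?thesis .
qed

lemma of_alg_smult:
  assumes a: "a \<in> carrier K" and v: "v \<in> alg_vectors K L"
  shows "of_alg (alg_smult K a v) = a \<odot>\<^bsub>V\<^esub> of_alg v"
proof -
  let ?s = "alg_smult K a v"
  have s: "?s \<in> alg_vectors K L" by (rule alg_smult_mem[OF well_order v a])
  have F: "finite (fst v)" "fst v \<subseteq> L"
    using v by (auto simp: mem_alg_vectors_iff)
  note closed = coord_closed[OF v] u_closed[OF subsetD[OF F(2)]] a
  \<comment> \<open>The inclusion can be strict only for \<open>a\<close> zero, when the product
    collapses to \<open>alg_zero\<close>.\<close>
  have "fst ?s \<subseteq> fst v" by (simp add: alg_smult_def alg_zero_def)
  then have "of_alg ?s = (\<Oplus>\<^bsub>V\<^esub>i\<in>fst v. alg_coord K r ?s i \<odot>\<^bsub>V\<^esub> u i)"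
    using s F by (intro of_alg_eq_finsum) auto
  also have "\<dots> = (\<Oplus>\<^bsub>V\<^esub>i\<in>fst v. a \<odot>\<^bsub>V\<^esub> (alg_coord K r v i \<odot>\<^bsub>V\<^esub> u i))"
    using closed
    by (intro M.finsum_cong')
      (simp_all add: Pi_iff alg_coord_smult[OF well_order v a] smult_assoc1)
  also have "\<dots> = a \<odot>\<^bsub>V\<^esub> of_alg v"
    unfolding of_alg_def using closed F by (intro finsum_smult[symmetric]) auto
  finally show ?thesis .
qed

section \<open>Bijectivity of the evaluation map\<close>

lemma inj_on_of_alg: "inj_on of_alg (alg_vectors K L)"
proof (rule inj_onI)
  fix v w assume v: "v \<in> alg_vectors K L" and w: "w \<in> alg_vectors K L"
    and eq: "of_alg v = of_alg w"
  have m1: "\<ominus>\<^bsub>K\<^esub> \<one>\<^bsub>K\<^esub> \<in> carrier K" by simp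
  \<comment> \<open>The difference of \<open>v\<close> and \<open>w\<close> is built from the two
    operations alone, because the algebraic vectors are not yet known to form a vector
    space.\<close>
  let ?n = "alg_smult K (\<ominus>\<^bsub>K\<^esub> \<one>\<^bsub>K\<^esub>) w"
  let ?d = "alg_add K r v ?n"
  have n: "?n \<in> alg_vectors K L" by (rule alg_smult_mem[OF well_order w m1])
  have d: "?d \<in> alg_vectors K L" by (rule alg_add_mem[OF well_order v n])
  have "of_alg ?d = \<zero>\<^bsub>V\<^esub>"
    using of_alg_closed[OF w]
    by (simp add: of_alg_add[OF v n] of_alg_smult[OF m1 w] eq smult_minus_1 M.r_neg)
  \<comment> \<open>Linear independence handles the indices of \<open>?d\<close>; elsewhere the
    coordinate is zero by default.\<close>
  then have zero: "alg_coord K r ?d i = \<zero>\<^bsub>K\<^esub>" for i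
    using finsum_u_eq_zero[of "fst ?d" "alg_coord K r ?d" i] d coord_closed[OF d]
      alg_coord_eq_zero_iff[OF well_order d]
    by (cases "i \<in> fst ?d") (auto simp: mem_alg_vectors_iff of_alg_def)
  have "alg_coord K r v i = alg_coord K r w i" for i
    using zero[of i] coord_closed[OF v, of i] coord_closed[OF w, of i]
    by (simp add: alg_coord_add[OF well_order v n] alg_coord_smult[OF well_order w m1]
        R.l_minus flip: R.minus_eq)
  then show "v = w" by (rule alg_coord_inject[OF well_order v w])
qed

lemma of_alg_surj:
  assumes "x \<in> carrier V"
  shows "x \<in> of_alg ` alg_vectors K L"
proof -
  have "x \<in> span (u ` L)"
    using assms basis by (simp add: basis_def)
  then obtain a A where A: "finite A" "A \<subseteq> u ` L" and a: "a \<in> A \<rightarrow> carrier K"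
    and x: "x = lincomb a A"
    by (auto simp: span_def)
  define F where "F = {i \<in> L. u i \<in> A}"
  \<comment> \<open>The combination obtained from the span may have zero coefficients, which a tuple
    cannot contain, so their indices are dropped.\<close>
  define S where "S = {i \<in> F. a (u i) \<noteq> \<zero>\<^bsub>K\<^esub>}"
  have uF: "u ` F = A" and FL: "F \<subseteq> L" and injF: "inj_on u F"
    using A(2) inj by (auto simp: F_def inj_on_def)
  then have "finite F" using A(1) finite_imageD by blast
  then have S: "finite S" "S \<subseteq> L" using FL by (auto simp: S_def)
  have aF: "a (u i) \<in> carrier K" if "i \<in> F" for i
    using that a uF by auto
  let ?v = "(S, map (\<lambda>i. a (u i)) (index_list r S))"
  have v: "?v \<in> alg_vectors K L"
    using S aF by (intro map_index_list_mem_alg_vectors[OF well_order]) (auto simp: S_def)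
  \<comment> \<open>At a dropped index both sides are zero, so the original sum over
    \<open>F\<close> is recovered unchanged.\<close>
  have coord: "alg_coord K r ?v i = a (u i)" if "i \<in> F" for i
    using that alg_comp_map[OF well_order S] by (auto simp: alg_coord_def S_def)
  have "x = (\<Oplus>\<^bsub>V\<^esub>i\<in>F. a (u i) \<odot>\<^bsub>V\<^esub> u i)"
    unfolding x lincomb_def uF[symmetric] using injF aF FL
    by (intro M.finsum_reindex) (auto simp: u_closed)
  also have "\<dots> = (\<Oplus>\<^bsub>V\<^esub>i\<in>F. alg_coord K r ?v i \<odot>\<^bsub>V\<^esub> u i)"
    using coord aF FL by (intro M.finsum_cong') (auto simp: u_closed)
  also have "\<dots> = of_alg ?v"
    using v \<open>finite F\<close> FL by (intro of_alg_eq_finsum[symmetric]) (auto simp: S_def)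
  finally show ?thesis using v by blast
qed

lemma bij_betw_of_alg: "bij_betw of_alg (alg_vectors K L) (carrier V)"
  using inj_on_of_alg of_alg_surj of_alg_closed by (auto simp: bij_betw_def)

end

theorem theorem3:
  fixes K :: "('k, 'n) ring_scheme"
    and E :: "('k, 'v, 'm) module_scheme"
    and L :: "'l set"
    and r :: "'l rel"
    and u :: "'l \<Rightarrow> 'v"
  assumes "vectorspace K E"
    and "well_order_on L r"
    and "inj_on u L"
    and "vectorspace.basis K E (u ` L)"
  shows "vectorspace K (alg_space K L r) \<and> vectorspace_iso K E (alg_space K L r)"
proof -
  interpret indexed_basis K E L r u
    by (intro indexed_basis.intro indexed_basis_axioms.intro assms)
  have "bij_betw of_alg (carrier (alg_space K L r)) (carrier E)"
    using bij_betw_of_alg by (simp add: alg_space_def)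
  note transport = vectorspace_transport[OF assms(1) this]
  show ?thesis
    by (intro conjI transport)
      (simp_all add: alg_space_def alg_zero_mem of_alg_zero alg_add_mem[OF well_order] of_alg_add
        alg_smult_mem[OF well_order] of_alg_smult)
qed

end
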